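(* Let $X$ be a $\sigma$-compact, locally compact and locally connected Hausdorff space. Consider on $X$ the simple coarse structure whose bounded sets are the pre-compact subsets of $X$ and whose equivalence relation on simple ends is Freudenthal-equivalence. Then the Higson compactification of $X$ with respect to this simple coarse structure is the Freudenthal compactification of $X$.
   Context: A subset of $X$ is pre-compact if its closure in $X$ is compact. Simple end (with pre-compact sets as bounded sets): a sequence $\{x_n\}_{n\ge1}$ in $X$ such that $\{n: x_n\in A\}$ is finite for every pre-compact set $A$. A simple coarse structure consists of such a choice of bounded sets together with an equivalence relation on the set of simple ends. Freudenthal-equivalence: two simple ends $\{x_n\}$ and $\{y_n\}$ are Freudenthal-equivalent if for every strictly increasing $a:\mathbb{N}\to\mathbb{N}$, every compact $K\subset X$ and every component $U$ of $X\setminus K$: (1) $x_{a(n)}\in U$ for all $n$ implies $y_{a(n)}\in U$ for all but finitely many $n$; (2) $y_{a(n)}\in U$ for all $n$ implies $x_{a(n)}\in U$ for all but finitely many $n$. A function $f:X\to Y$ to a metric space is slowly oscillating if $d_Y(f(x_n),f(y_n))\to0$ for all equivalent simple ends $\{x_n\},\{y_n\}$. The Higson compactification of $X$ is the compactification $\bar X$ such that a function $X\to[0,1]$ extends to a continuous function $\bar X\to[0,1]$ if and only if it is continuous and slowly oscillating. The Freudenthal compactification of $X$ is characterized as the compactification $\bar X$ of $X$ whose corona $\bar X\setminus X$ is of dimension $0$ and which dominates every compactification $\hat X$ of $X$ whose corona $\hat X\setminus X$ is of dimension $0$ (domination: the identity of $X$ extends to a continuous map $\bar X\to\hat X$).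
   Formalization: The formal theorem additionally assumes that X has finitely many connected components; without this the claim fails (e.g. for X the discrete natural numbers, whose Higson compactification here is the one-point compactification). *)

theory Defs
  imports "HOL-Analysis.Analysis"
begin

definition sigma_compact_space :: "'a topology \<Rightarrow> bool" where
  "sigma_compact_space X \<longleftrightarrow>
     (\<exists>K :: nat \<Rightarrow> 'a set. (\<forall>n. compactin X (K n)) \<and> topspace X = (\<Union>n. K n))"

section \<open>Simple coarse structures\<close>

definition precompact_sets :: "'a topology \<Rightarrow> 'a set set" where
  "precompact_sets X = {A. A \<subseteq> topspace X \<and> compactin X (X closure_of A)}"

definition simple_ends :: "'a set \<Rightarrow> 'a set set \<Rightarrow> (nat \<Rightarrow> 'a) set" where
  "simple_ends S \<B> = {x. range x \<subseteq> S \<and> (\<forall>A\<in>\<B>. finite {n. x n \<in> A})}"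

definition simple_coarse_structure ::
    "'a set \<Rightarrow> 'a set set \<Rightarrow> ((nat \<Rightarrow> 'a) \<times> (nat \<Rightarrow> 'a)) set \<Rightarrow> bool" where
  "simple_coarse_structure S \<B> R \<longleftrightarrow> \<B> \<subseteq> Pow S \<and> equiv (simple_ends S \<B>) R"

definition freudenthal_equiv :: "'a topology \<Rightarrow> ((nat \<Rightarrow> 'a) \<times> (nat \<Rightarrow> 'a)) set" where
  "freudenthal_equiv X =
     {(x, y). x \<in> simple_ends (topspace X) (precompact_sets X) \<and>
        y \<in> simple_ends (topspace X) (precompact_sets X) \<and>
        (\<forall>(a :: nat \<Rightarrow> nat) K U.
           strict_mono a \<longrightarrow> compactin X K \<longrightarrow>
           U \<in> connected_components_of (subtopology X (topspace X - K)) \<longrightarrow>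
             ((\<forall>n. x (a n) \<in> U) \<longrightarrow> (\<forall>\<^sub>F n in sequentially. y (a n) \<in> U)) \<and>
             ((\<forall>n. y (a n) \<in> U) \<longrightarrow> (\<forall>\<^sub>F n in sequentially. x (a n) \<in> U)))}"

text \<open>If \<open>X\<close> has infinitely many components, then ends running through infinitely many of
  them are hardly constrained: in the discrete space \<open>\<nat>\<close> the condition is vacuous and all simple
  ends are equivalent, so the Higson compactification is the one-point compactification, which
  does not dominate the compactification of \<open>\<nat>\<close> by two points. The identification with the
  Freudenthal compactification therefore needs \<open>X\<close> to have finitely many components
  (in particular it covers connected \<open>X\<close>).\<close>

lemma freudenthal_equiv_step:
  assumes "(x, y) \<in> freudenthal_equiv X" "strict_mono (a :: nat \<Rightarrow> nat)" "compactin X K"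
    "U \<in> connected_components_of (subtopology X (topspace X - K))"
    "\<forall>\<^sub>F n in sequentially. x (a n) \<in> U"
  shows "\<forall>\<^sub>F n in sequentially. y (a n) \<in> U"
proof -
  obtain N where N: "\<And>n. n \<ge> N \<Longrightarrow> x (a n) \<in> U"
    using assms(5) by (auto simp: eventually_sequentially)
  have "strict_mono (\<lambda>n. a (n + N))"
    using assms(2) by (simp add: strict_mono_def)
  moreover have "\<forall>n. x (a (n + N)) \<in> U" using N by simp
  ultimately have "\<forall>\<^sub>F n in sequentially. y (a (n + N)) \<in> U"
    using assms(1,3,4) unfolding freudenthal_equiv_def by blast
  then show ?thesis
    using eventually_sequentially_seg[of "\<lambda>n. y (a n) \<in> U" N] by simp
qed

lemma sym_freudenthal_equiv: "sym (freudenthal_equiv X)"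
  unfolding freudenthal_equiv_def by (rule symI) blast

lemma simple_coarse_structure_freudenthal:
  "simple_coarse_structure (topspace X) (precompact_sets X) (freudenthal_equiv X)"
proof -
  let ?R = "freudenthal_equiv X"
  have "trans ?R"
  proof (rule transI)
    fix x y z assume xy: "(x, y) \<in> ?R" and yz: "(y, z) \<in> ?R"
    have yx: "(y, x) \<in> ?R" and zy: "(z, y) \<in> ?R"
      using xy yz sym_freudenthal_equiv by (auto dest: symD)
    have 1: "\<forall>\<^sub>F n in sequentially. z (a n) \<in> U"
      if "strict_mono a" "compactin X K"
        "U \<in> connected_components_of (subtopology X (topspace X - K))" "\<forall>n. x (a n) \<in> U"
      for a :: "nat \<Rightarrow> nat" and K U
      using freudenthal_equiv_step[OF yz that(1-3)] freudenthal_equiv_step[OF xy that(1-3)]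
        that(4) by simp
    have 2: "\<forall>\<^sub>F n in sequentially. x (a n) \<in> U"
      if "strict_mono a" "compactin X K"
        "U \<in> connected_components_of (subtopology X (topspace X - K))" "\<forall>n. z (a n) \<in> U"
      for a :: "nat \<Rightarrow> nat" and K U
      using freudenthal_equiv_step[OF yx that(1-3)] freudenthal_equiv_step[OF zy that(1-3)]
        that(4) by simp
    show "(x, z) \<in> ?R"
      using xy yz 1 2 unfolding freudenthal_equiv_def by blast
  qed
  moreover have "refl_on (simple_ends (topspace X) (precompact_sets X)) ?R"
    by (auto simp: refl_on_def freudenthal_equiv_def)
  moreover have "?R \<subseteq> simple_ends (topspace X) (precompact_sets X) \<times>
      simple_ends (topspace X) (precompact_sets X)"
    by (auto simp: freudenthal_equiv_def)
  ultimately show ?thesis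
    using sym_freudenthal_equiv
    by (auto simp: simple_coarse_structure_def equiv_def precompact_sets_def)
qed

definition slowly_oscillating ::
    "((nat \<Rightarrow> 'a) \<times> (nat \<Rightarrow> 'a)) set \<Rightarrow> ('a \<Rightarrow> 'm::metric_space) \<Rightarrow> bool" where
  "slowly_oscillating R f \<longleftrightarrow>
     (\<forall>(x, y) \<in> R. (\<lambda>n. dist (f (x n)) (f (y n))) \<longlonglongrightarrow> 0)"

section \<open>Compactifications\<close>

text \<open>A compactification of \<open>X\<close> is a compact Hausdorff space \<open>Y\<close> together with a dense
  embedding \<open>e\<close> of \<open>X\<close>; the inclusion of \<open>X\<close> in \<open>Y\<close> becomes the map \<open>e\<close>.\<close>

definition compactification :: "'a topology \<Rightarrow> 'b topology \<Rightarrow> ('a \<Rightarrow> 'b) \<Rightarrow> bool" where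
  "compactification X Y e \<longleftrightarrow>
     compact_space Y \<and> Hausdorff_space Y \<and> embedding_map X Y e \<and>
     Y closure_of (e ` topspace X) = topspace Y"

definition corona :: "'a topology \<Rightarrow> 'b topology \<Rightarrow> ('a \<Rightarrow> 'b) \<Rightarrow> 'b topology" where
  "corona X Y e = subtopology Y (topspace Y - e ` topspace X)"

definition dominates ::
    "'a topology \<Rightarrow> 'b topology \<Rightarrow> ('a \<Rightarrow> 'b) \<Rightarrow> 'c topology \<Rightarrow> ('a \<Rightarrow> 'c) \<Rightarrow> bool" where
  "dominates X Y e Z h \<longleftrightarrow>
     (\<exists>\<phi>. continuous_map Y Z \<phi> \<and> (\<forall>x\<in>topspace X. \<phi> (e x) = h x))"

definition higson_compactification ::
    "'a topology \<Rightarrow> ((nat \<Rightarrow> 'a) \<times> (nat \<Rightarrow> 'a)) set \<Rightarrow> 'b topology \<Rightarrow> ('a \<Rightarrow> 'b) \<Rightarrow> bool" where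
  "higson_compactification X R Y e \<longleftrightarrow>
     compactification X Y e \<and>
     (\<forall>f :: 'a \<Rightarrow> real. f \<in> topspace X \<rightarrow> {0..1} \<longrightarrow>
        ((\<exists>g. continuous_map Y (top_of_set {0..1}) g \<and> (\<forall>x\<in>topspace X. g (e x) = f x)) \<longleftrightarrow>
         continuous_map X (top_of_set {0..1}) f \<and> slowly_oscillating R f))"

text \<open>Coronas are compact Hausdorff (for locally compact \<open>X\<close>), so dimension 0 may be read with
  the library's small inductive dimension. Using \<open>dim_le 0\<close> also admits the empty corona,
  which occurs only for compact \<open>X\<close>, whose only compactification is \<open>X\<close> itself.

  A definition in HOL cannot quantify over all types, so the type \<open>'c\<close> carrying the competing
  compactifications is a parameter. The type \<open>('a \<Rightarrow> real) \<Rightarrow> real\<close> is large enough to carry a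
  copy of every compactification of \<open>X\<close>: send \<open>y\<close> to the map taking each extendable \<open>f\<close> to the
  value at \<open>y\<close> of its extension.\<close>

definition freudenthal_compactification ::
    "'c itself \<Rightarrow> 'a topology \<Rightarrow> 'b topology \<Rightarrow> ('a \<Rightarrow> 'b) \<Rightarrow> bool" where
  "freudenthal_compactification T X Y e \<longleftrightarrow>
     compactification X Y e \<and> corona X Y e dim_le 0 \<and>
     (\<forall>(Z :: 'c topology) h. compactification X Z h \<and> corona X Z h dim_le 0 \<longrightarrow>
        dominates X Y e Z h)"

end

theory Submission
  imports Defs
begin

text \<open>Since \<open>X\<close> is locally connected with finitely many components, only finitely many components of
  the complement of a compact set \<open>K\<close> leave a given compact neighbourhood of \<open>K\<close>. Hence two simple
  ends are Freudenthal-equivalent iff they eventually lie in the same component of \<open>X - K\<close>, for every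
  compact \<open>K\<close>, and by \<open>\<sigma>\<close>-compactness \<open>f\<close> is slowly oscillating iff for each \<open>\<epsilon>\<close> there is a compact
  \<open>K\<close> such that \<open>f\<close> oscillates by less than \<open>\<epsilon>\<close> on each component of \<open>X - K\<close>.

  If a compactification has a corona of dimension 0, then every extendable function is of this
  kind: the corona splits into two clopen pieces according to the values of the extension, these
  have disjoint neighbourhoods, and a connected set near infinity stays in one of them. Conversely,
  if all such functions extend and the extensions separate points of the corona, then the corona
  has dimension 0: the components of \<open>X - K\<close> on which \<open>f\<close> is somewhere small have a union whose
  indicator function, cut off near \<open>K\<close>, extends and takes only the values 0 and 1 on the corona.
  Both halves of the theorem follow, the existence of the Higson compactification being obtained
  by closing up \<open>X\<close> in the cube spanned by these functions.\<close>

section \<open>Ends and components of complements of compact sets\<close>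

text \<open>By local compactness every \<open>K n\<close> has an open neighbourhood
  \<open>U n\<close> inside a compact \<open>L n\<close>. The sets \<open>U n\<close> cover the
  space, so a compact set lies in finitely many of them and hence in all late unions of the
  \<open>L i\<close>.\<close>

lemma compact_exhaustion:
  assumes "sigma_compact_space X" "locally_compact_space X" "Hausdorff_space X"
  obtains M :: "nat \<Rightarrow> 'a set"
  where "\<And>n. compactin X (M n)"
    and "\<And>A. compactin X A \<Longrightarrow> \<forall>\<^sub>F n in sequentially. A \<subseteq> M n"
proof -
  obtain K :: "nat \<Rightarrow> 'a set" where K: "\<And>n. compactin X (K n)" "topspace X = (\<Union>n. K n)"
    using assms(1) unfolding sigma_compact_space_def by blast
  have "\<forall>n. \<exists>U L. openin X U \<and> compactin X L \<and> K n \<subseteq> U \<and> U \<subseteq> L"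
    using assms(2,3) K(1) locally_compact_space_compact_closed_compact by metis
  then obtain U L where UL: "\<And>n. openin X (U n)" "\<And>n. compactin X (L n)"
    "\<And>n. K n \<subseteq> U n" "\<And>n. U n \<subseteq> L n"
    by metis
  show thesis
  proof
    show "compactin X (\<Union>i\<le>n. L i)" for n
      using UL(2) by (intro compactin_Union) auto
    fix A assume A: "compactin X A"
    have "A \<subseteq> \<Union>(range U)"
      using compactin_subset_topspace[OF A] K(2) UL(3) by blast
    then obtain \<F> where \<F>: "finite \<F>" "\<F> \<subseteq> range U" "A \<subseteq> \<Union>\<F>"
      using compactinD[OF A, of "range U"] UL(1) by blast
    then obtain I where I: "finite I" "\<F> = U ` I"
      by (meson finite_subset_image)
    obtain N where N: "\<And>i. i \<in> I \<Longrightarrow> i \<le> N"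
      using I(1) unfolding finite_nat_set_iff_bounded_le by blast
    then have "A \<subseteq> (\<Union>i\<le>n. L i)" if "n \<ge> N" for n
    proof -
      have "A \<subseteq> (\<Union>i\<in>I. L i)"
        using \<F>(3) I(2) UL(4) by blast
      also have "\<dots> \<subseteq> (\<Union>i\<le>n. L i)"
        using N \<open>n \<ge> N\<close> by (intro UN_mono) (auto intro: order_trans)
      finally show ?thesis .
    qed
    then show "\<forall>\<^sub>F n in sequentially. A \<subseteq> (\<Union>i\<le>n. L i)"
      by (auto simp: eventually_sequentially)
  qed
qed

text \<open>Compact sets are closed, hence pre-compact, and a pre-compact set lies in its compact
  closure, so testing ends on compact sets is enough.\<close>

lemma simple_ends_iff:
  assumes "Hausdorff_space X"
  shows "x \<in> simple_ends (topspace X) (precompact_sets X) \<longleftrightarrow>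
    range x \<subseteq> topspace X \<and> (\<forall>K. compactin X K \<longrightarrow> (\<forall>\<^sub>F n in sequentially. x n \<notin> K))"
proof -
  have fin: "finite {n. x n \<in> A} \<longleftrightarrow> (\<forall>\<^sub>F n in sequentially. x n \<notin> A)" for A
    by (simp add: eventually_cofinite flip: cofinite_eq_sequentially)
  have "(\<forall>A\<in>precompact_sets X. \<forall>\<^sub>F n in sequentially. x n \<notin> A) \<longleftrightarrow>
     (\<forall>K. compactin X K \<longrightarrow> (\<forall>\<^sub>F n in sequentially. x n \<notin> K))" (is "?l \<longleftrightarrow> ?r")
  proof
    assume ?l
    moreover have "K \<in> precompact_sets X" if "compactin X K" for K
      using that assms closure_of_closedin[OF compactin_imp_closedin] compactin_subset_topspace
      unfolding precompact_sets_def by fastforce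
    ultimately show ?r by blast
  next
    assume r: ?r
    show ?l
    proof
      fix A assume "A \<in> precompact_sets X"
      then have "A \<subseteq> X closure_of A" "compactin X (X closure_of A)"
        by (auto simp: precompact_sets_def closure_of_subset)
      then show "\<forall>\<^sub>F n in sequentially. x n \<notin> A"
        using r by (smt (verit) eventually_mono subsetD)
    qed
  qed
  then show ?thesis
    by (simp add: simple_ends_def fin)
qed

text \<open>By local connectedness the components of X - K are open, and they are disjoint. They
  cover the frontier of \<open>L\<close>, which is compact and misses \<open>K\<close>, so only
  finitely many meet it. A component that misses the frontier without lying in \<open>L\<close>
  turns out to be a component of \<open>X\<close>, and there are finitely many of these.\<close>

lemma finite_components_outside_compact:
  assumes "Hausdorff_space X" "locally_connected_space X" "finite (connected_components_of X)"
    and "compactin X K" "compactin X L" "K \<subseteq> X interior_of L"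
  shows "finite {U \<in> connected_components_of (subtopology X (topspace X - K)). \<not> U \<subseteq> L}"
proof -
  let ?S = "subtopology X (topspace X - K)"
  let ?F = "X frontier_of L"
  have opn: "openin X (topspace X - K)"
    using assms(1,4) compactin_imp_closedin by blast
  have comp_open: "openin X U" if "U \<in> connected_components_of ?S" for U
    using assms(2) opn that locally_connected_space_open_connected_components by blast
  have "compactin X ?F"
    by (meson assms(1,5) closedin_frontier_of closed_compactin compactin_imp_closedin
        frontier_of_subset_closedin)
  moreover have "?F \<subseteq> topspace X - K"
    using assms(6) frontier_of_subset_topspace by (fastforce simp: frontier_of_def)
  then have "?F \<subseteq> \<Union>(connected_components_of ?S)"
    by (simp add: Union_connected_components_of frontier_of_subset_topspace)
  ultimately obtain \<F> where \<F>: "finite \<F>" "\<F> \<subseteq> connected_components_of ?S" "?F \<subseteq> \<Union>\<F>"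
    using compactinD[of X ?F "connected_components_of ?S"] comp_open by blast
  have "U \<in> \<F> \<union> connected_components_of X"
    if U: "U \<in> connected_components_of ?S" "\<not> U \<subseteq> L" for U
  proof (cases "U \<inter> ?F = {}")
    case False
    then obtain V where "V \<in> \<F>" "V \<inter> U \<noteq> {}"
      using \<F>(3) by blast
    then show ?thesis
      using U(1) \<F>(2) pairwise_disjoint_connected_components_of[of ?S]
      by (metis UnI1 disjnt_def pairwiseD subsetD)
  next
    \<comment> \<open>\<open>U\<close> misses \<open>L\<close> altogether, so it is clopen in \<open>X\<close> and thus a component of \<open>X\<close>.\<close>
    case True
    have conU: "connectedin X U"
      using U(1) connectedin_connected_components_of connectedin_subtopology by blast
    have "U \<inter> L = {}"
      using connectedin_Int_frontier_of[OF conU, of L] True U(2) by blast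
    \<comment> \<open>The interior of \<open>L\<close> is open and disjoint from \<open>U\<close>,
      hence disjoint from the closure of \<open>U\<close>. The closure therefore avoids
      \<open>K\<close>, so that \<open>U\<close>, closed in X - K, is closed in
      \<open>X\<close>.\<close>
    moreover have "X interior_of L \<subseteq> L"
      by (rule interior_of_subset)
    ultimately have "X closure_of U \<subseteq> topspace X - X interior_of L"
      by (intro closure_of_minimal)
        (use connectedin_subset_topspace[OF conU] in \<open>auto intro: closedin_diff\<close>)
    then have "X closure_of U \<subseteq> topspace X - K"
      using assms(6) by blast
    moreover have "closedin ?S U"
      by (rule closedin_connected_components_of[OF U(1)])
    ultimately have clU: "closedin X U"
      by (smt (verit) closedin_Int_closure_of closure_of_subset_eq inf.absorb_iff2 inf_commute
          connectedin_subset_topspace[OF conU] order_refl)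
    obtain u where u: "u \<in> U" "u \<in> topspace X"
      using nonempty_connected_components_of[OF U(1)] connectedin_subset_topspace[OF conU] by blast
    have "U \<subseteq> connected_component_of_set X u"
      by (rule connected_component_of_maximal[OF conU u(1)])
    moreover have "connected_component_of_set X u \<subseteq> U"
      using connectedin_clopen_cases[OF connectedin_connected_component_of clU comp_open[OF U(1)]]
        calculation u(1) by (fastforce simp: disjnt_iff)
    ultimately show ?thesis
      using u(2) by (auto simp: connected_components_of_def)
  qed
  then show ?thesis
    by (intro finite_subset[OF _ finite_UnI[OF \<F>(1) assms(3)]]) blast
qed

text \<open>The forward direction is a pigeonhole argument: if \<open>x n\<close> and
  \<open>y n\<close> were separated infinitely often, one of the finitely many relevant components
  would contain \<open>x n\<close> for infinitely many of these n, contradicting equivalence along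
  that subsequence.\<close>

lemma freudenthal_equiv_iff:
  assumes "locally_compact_space X" "locally_connected_space X" "Hausdorff_space X"
    "finite (connected_components_of X)"
  shows "(x, y) \<in> freudenthal_equiv X \<longleftrightarrow>
     x \<in> simple_ends (topspace X) (precompact_sets X) \<and>
     y \<in> simple_ends (topspace X) (precompact_sets X) \<and>
     (\<forall>K. compactin X K \<longrightarrow> (\<forall>\<^sub>F n in sequentially.
        connected_component_of (subtopology X (topspace X - K)) (x n) (y n)))"
    (is "?l \<longleftrightarrow> ?r")
proof
  assume r: ?r
  have both: "\<forall>\<^sub>F n in sequentially. y (a n) \<in> U \<longleftrightarrow> x (a n) \<in> U"
    if "strict_mono a" "compactin X K"
      and U: "U \<in> connected_components_of (subtopology X (topspace X - K))"
    for a :: "nat \<Rightarrow> nat" and K U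
  proof -
    have "\<forall>\<^sub>F n in sequentially. connected_component_of (subtopology X (topspace X - K)) (x (a n)) (y (a n))"
      by (rule eventually_subseq[OF that(1)]) (use r that(2) in blast)
    then show ?thesis
    proof (rule eventually_mono)
      fix n assume n: "connected_component_of (subtopology X (topspace X - K)) (x (a n)) (y (a n))"
      obtain u where "U = connected_component_of_set (subtopology X (topspace X - K)) u"
        using U by (auto simp: connected_components_of_def)
      then show "y (a n) \<in> U \<longleftrightarrow> x (a n) \<in> U"
        using n connected_component_of_trans connected_component_of_sym by (metis mem_Collect_eq)
    qed
  qed
  have "((\<forall>n. x (a n) \<in> U) \<longrightarrow> (\<forall>\<^sub>F n in sequentially. y (a n) \<in> U)) \<and>
        ((\<forall>n. y (a n) \<in> U) \<longrightarrow> (\<forall>\<^sub>F n in sequentially. x (a n) \<in> U))"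
    if "strict_mono a" "compactin X K"
      "U \<in> connected_components_of (subtopology X (topspace X - K))" for a :: "nat \<Rightarrow> nat" and K U
    using both[OF that] by auto
  then show ?l
    using r unfolding freudenthal_equiv_def by blast
next
  assume l: ?l
  have ends: "x \<in> simple_ends (topspace X) (precompact_sets X)"
    "y \<in> simple_ends (topspace X) (precompact_sets X)"
    using l by (auto simp: freudenthal_equiv_def)
  moreover have "\<forall>\<^sub>F n in sequentially. connected_component_of (subtopology X (topspace X - K)) (x n) (y n)"
    if K: "compactin X K" for K
  proof (rule ccontr)
    let ?S = "subtopology X (topspace X - K)"
    assume neg: "\<not> (\<forall>\<^sub>F n in sequentially. connected_component_of ?S (x n) (y n))"
    \<comment> \<open>The end \<open>x\<close> eventually leaves the compact neighbourhood
      \<open>L\<close> of \<open>K\<close>, so only components of X - K not contained in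
      \<open>L\<close> matter, and these are finite in number.\<close>
    obtain V L where VL: "openin X V" "compactin X L" "K \<subseteq> V" "V \<subseteq> L"
      using assms(1,3) K locally_compact_space_compact_closed_compact by metis
    then have KL: "K \<subseteq> X interior_of L"
      by (meson interior_of_maximal order_trans)
    define \<C> where "\<C> = {U \<in> connected_components_of ?S. \<not> U \<subseteq> L}"
    define N where "N = {n. \<not> connected_component_of ?S (x n) (y n) \<and> x n \<notin> L}"
    have "\<forall>\<^sub>F n in sequentially. x n \<notin> L"
      using ends(1) VL(2) assms(3) by (simp add: simple_ends_iff)
    then have "\<exists>\<^sub>F n in sequentially. \<not> connected_component_of ?S (x n) (y n) \<and> x n \<notin> L"
      using neg by (simp add: frequently_def)
        (smt (verit) eventually_elim2)
    then have infN: "infinite N"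
      by (simp add: N_def frequently_cofinite flip: cofinite_eq_sequentially)
    have "\<exists>U\<in>\<C>. x n \<in> U" if "n \<in> N" for n
    proof -
      have "x n \<in> topspace ?S"
        using that ends(1) VL(3,4) by (auto simp: N_def simple_ends_def)
      then show ?thesis
        using that Union_connected_components_of[of ?S] unfolding \<C>_def N_def by blast
    qed
    then have "N \<subseteq> (\<Union>U\<in>\<C>. {n\<in>N. x n \<in> U})"
      by blast
    moreover have "finite \<C>"
      unfolding \<C>_def
      by (rule finite_components_outside_compact[OF assms(3,2,4) K VL(2) KL])
    ultimately obtain U where U: "U \<in> \<C>" "infinite {n\<in>N. x n \<in> U}"
      using infN by (meson finite_UN_I finite_subset)
    define a where "a = enumerate {n\<in>N. x n \<in> U}"
    have a: "strict_mono a" "\<And>n. a n \<in> N \<and> x (a n) \<in> U"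
      using U(2) enumerate_in_set[OF U(2)] by (auto simp: a_def strict_mono_enumerate)
    have Uc: "U \<in> connected_components_of ?S"
      using U(1) by (simp add: \<C>_def)
    have "\<forall>\<^sub>F n in sequentially. y (a n) \<in> U"
      using freudenthal_equiv_step[OF l a(1) K Uc] a(2) by simp
    then obtain n where "y (a n) \<in> U"
      by (meson eventually_happens sequentially_bot)
    then have "connected_component_of ?S (x (a n)) (y (a n))"
      using a(2)[of n] connectedin_connected_components_of[OF Uc]
      by (auto simp: connected_component_of_def)
    then show False
      using a(2)[of n] by (simp add: N_def)
  qed
  ultimately show ?r by blast
qed

section \<open>Slow oscillation expressed without sequences\<close>

text \<open>\<open>connected_component_of\<close> relates only points of the given subspace, so the
  bound says nothing about the values of \<open>f\<close> on \<open>K\<close>.\<close>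

definition vanishing_oscillation :: "'a topology \<Rightarrow> ('a \<Rightarrow> 'm::metric_space) \<Rightarrow> bool" where
  "vanishing_oscillation X f \<longleftrightarrow>
     (\<forall>\<epsilon>>0. \<exists>K. compactin X K \<and>
        (\<forall>x y. connected_component_of (subtopology X (topspace X - K)) x y \<longrightarrow>
           dist (f x) (f y) < \<epsilon>))"

text \<open>If the uniform condition fails for some \<epsilon>, a bad pair exists outside each
  member of a compact exhaustion, and these pairs form two equivalent ends along which
  \<open>f\<close> violates slow oscillation.\<close>

lemma slowly_oscillating_iff:
  assumes "sigma_compact_space X" "locally_compact_space X" "locally_connected_space X"
    "Hausdorff_space X" "finite (connected_components_of X)"
  shows "slowly_oscillating (freudenthal_equiv X) f \<longleftrightarrow> vanishing_oscillation X f"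
proof
  assume "vanishing_oscillation X f"
  then show "slowly_oscillating (freudenthal_equiv X) f"
    unfolding slowly_oscillating_def vanishing_oscillation_def tendsto_iff
    by (auto simp: freudenthal_equiv_iff[OF assms(2-5)]) (smt (verit) eventually_mono)
next
  assume so: "slowly_oscillating (freudenthal_equiv X) f"
  show "vanishing_oscillation X f"
  proof (rule ccontr)
    assume "\<not> vanishing_oscillation X f"
    then obtain \<epsilon> where \<epsilon>: "\<epsilon> > 0" and no: "\<And>K. compactin X K \<Longrightarrow>
       \<exists>x y. connected_component_of (subtopology X (topspace X - K)) x y \<and> \<epsilon> \<le> dist (f x) (f y)"
      unfolding vanishing_oscillation_def by (meson not_less)
    obtain M where M: "\<And>n. compactin X (M n)"
      "\<And>A. compactin X A \<Longrightarrow> \<forall>\<^sub>F n in sequentially. A \<subseteq> M n"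
      using compact_exhaustion assms(1,2,4) by blast
    obtain x y where xy:
      "\<And>n. connected_component_of (subtopology X (topspace X - M n)) (x n) (y n)"
      "\<And>n. \<epsilon> \<le> dist (f (x n)) (f (y n))"
      using no[OF M(1)] by metis
    have mem: "x n \<in> topspace X - M n" "y n \<in> topspace X - M n" for n
      using connected_component_in_topspace[OF xy(1)[of n]] by auto
    \<comment> \<open>Once \<open>M n\<close> contains \<open>K\<close>, both points lie outside
      \<open>K\<close>, and a component of X - \<open>M n\<close> sits inside a component of X -
      K.\<close>
    have "(x, y) \<in> freudenthal_equiv X"
      unfolding freudenthal_equiv_iff[OF assms(2-5)] simple_ends_iff[OF assms(4)]
    proof (intro conjI allI impI)
      fix K assume K: "compactin X K"
      show "\<forall>\<^sub>F n in sequentially. x n \<notin> K" "\<forall>\<^sub>F n in sequentially. y n \<notin> K"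
        by (rule eventually_mono[OF M(2)[OF K]], use mem in blast)+
      show "\<forall>\<^sub>F n in sequentially. connected_component_of (subtopology X (topspace X - K)) (x n) (y n)"
        by (rule eventually_mono[OF M(2)[OF K]], rule connected_component_of_mono[OF xy(1)]) blast
    qed (use mem in auto)
    then have "(\<lambda>n. dist (f (x n)) (f (y n))) \<longlonglongrightarrow> 0"
      using so by (auto simp: slowly_oscillating_def)
    then have "\<forall>\<^sub>F n in sequentially. dist (f (x n)) (f (y n)) < \<epsilon>"
      using \<epsilon> by (simp add: tendsto_iff)
    then obtain n where "dist (f (x n)) (f (y n)) < \<epsilon>"
      by (meson eventually_happens sequentially_bot)
    with xy(2)[of n] show False by simp
  qed
qed

section \<open>Compactifications with zero-dimensional corona\<close>

text \<open>Each point of \<open>A\<close> has a clopen neighbourhood missing \<open>B\<close>. By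
  compactness finitely many cover \<open>A\<close>, and a finite union of clopen sets is
  clopen.\<close>

lemma dim_le_0_clopen_separation:
  assumes "X dim_le 0" "compactin X A" "closedin X B" "disjnt A B"
  obtains D where "closedin X D" "openin X D" "A \<subseteq> D" "disjnt D B"
proof -
  define \<U> where "\<U> = {U. closedin X U \<and> openin X U \<and> disjnt U B}"
  have "\<exists>U\<in>\<U>. a \<in> U" if "a \<in> A" for a
  proof -
    have "openin X (topspace X - B)" "a \<in> topspace X - B"
      using assms that compactin_subset_topspace by (auto simp: disjnt_iff)
    then obtain U where "closedin X U \<and> openin X U" "a \<in> U" "U \<subseteq> topspace X - B"
      using assms(1) unfolding dimension_le_0_neighbourhood_base_of_clopen
      by (subst (asm) open_neighbourhood_base_of) blast+
    then show ?thesis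
      unfolding \<U>_def disjnt_iff by blast
  qed
  then obtain \<F> where \<F>: "finite \<F>" "\<F> \<subseteq> \<U>" "A \<subseteq> \<Union>\<F>"
    using compactinD[OF assms(2), of \<U>] by (fastforce simp: \<U>_def)
  show thesis
  proof
    show "closedin X (\<Union>\<F>)" "openin X (\<Union>\<F>)" "disjnt (\<Union>\<F>) B"
      using \<F> by (auto simp: \<U>_def disjnt_iff intro!: closedin_Union)
  qed (rule \<F>(3))
qed

text \<open>The complement of \<open>W\<close> is compact, so finitely many clopen sets avoiding
  \<open>x\<close> cover it. The complement of their union is the clopen neighbourhood
  required.\<close>

lemma compact_space_imp_dim_le_0:
  assumes "compact_space X"
    and sep: "\<And>x y. \<lbrakk>x \<in> topspace X; y \<in> topspace X; x \<noteq> y\<rbrakk> \<Longrightarrow>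
       \<exists>D. closedin X D \<and> openin X D \<and> x \<in> D \<and> y \<notin> D"
  shows "X dim_le 0"
  unfolding dimension_le_0_neighbourhood_base_of_clopen
proof (subst open_neighbourhood_base_of; clarify?)
  fix W x assume W: "openin X W" "x \<in> W"
  define \<U> where "\<U> = {U. closedin X U \<and> openin X U \<and> x \<notin> U}"
  have x: "x \<in> topspace X"
    using W openin_subset by blast
  have "\<exists>U\<in>\<U>. y \<in> U" if y: "y \<in> topspace X - W" for y
  proof -
    obtain D where "closedin X D" "openin X D" "y \<in> D" "x \<notin> D"
      using sep[of y x] x y W(2) by blast
    then show ?thesis by (auto simp: \<U>_def)
  qed
  moreover have "compactin X (topspace X - W)"
    using assms(1) W(1) closedin_compact_space by blast
  ultimately obtain \<F> where \<F>: "finite \<F>" "\<F> \<subseteq> \<U>" "topspace X - W \<subseteq> \<Union>\<F>"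
    using compactinD[of X "topspace X - W" \<U>] by (fastforce simp: \<U>_def)
  have "closedin X (\<Union>\<F>)" "openin X (\<Union>\<F>)"
    using \<F>(1,2) by (auto simp: \<U>_def intro!: closedin_Union)
  then show "\<exists>U. (closedin X U \<and> openin X U) \<and> x \<in> U \<and> U \<subseteq> W"
    using \<F>(2,3) x by (intro exI[of _ "topspace X - \<Union>\<F>"]) (auto simp: \<U>_def)
qed

text \<open>Tychonoff's embedding by evaluation. The map is restricted to \<open>F\<close> because
  points of \<open>product_topology\<close> are extensional functions. Applying \<open>sep\<close>
  to singletons gives injectivity.\<close>

lemma embedding_map_into_cube:
  fixes F :: "('a \<Rightarrow> real) set"
  assumes "t1_space X"
    and cont: "\<And>f. f \<in> F \<Longrightarrow> continuous_map X (top_of_set {0..1}) f"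
    and sep: "\<And>A x. \<lbrakk>closedin X A; x \<in> topspace X; x \<notin> A\<rbrakk> \<Longrightarrow> \<exists>f\<in>F. f x = 0 \<and> f ` A \<subseteq> {1}"
  shows "embedding_map X (product_topology (\<lambda>_. top_of_set {0..1}) F) (\<lambda>x. \<lambda>f\<in>F. f x)"
    (is "embedding_map X ?P ?e")
  unfolding embedding_map_def
proof (rule bijective_open_imp_homeomorphic_map)
  have con: "continuous_map X ?P ?e"
    using cont by (auto simp: continuous_map_componentwise)
  then show "continuous_map X (subtopology ?P (?e ` topspace X)) ?e"
    by (auto simp: continuous_map_in_subtopology)
  show "?e ` topspace X = topspace (subtopology ?P (?e ` topspace X))"
    using continuous_map_image_subset_topspace[OF con] by auto
  show "inj_on ?e (topspace X)"
  proof (rule inj_onI, rule ccontr)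
    fix x y assume xy: "x \<in> topspace X" "y \<in> topspace X" "?e x = ?e y" "x \<noteq> y"
    obtain f where f: "f \<in> F" "f x = 0" "f ` {y} \<subseteq> {1}"
      using sep[of "{y}" x] xy assms(1) by (auto simp: t1_space_closedin_singleton)
    then show False
      using fun_cong[OF xy(3), of f] by simp
  qed
  show "open_map X (subtopology ?P (?e ` topspace X)) ?e"
    unfolding open_map_def
  proof clarify
    fix U assume U: "openin X U"
    show "openin (subtopology ?P (?e ` topspace X)) (?e ` U)"
    proof (subst openin_subopen, clarify)
      fix x assume x: "x \<in> U"
      obtain f where f: "f \<in> F" "f x = 0" "f ` (topspace X - U) \<subseteq> {1}"
        using sep[of "topspace X - U" x] U x openin_subset by blast
      \<comment> \<open>Since \<open>f\<close> is 1 off \<open>U\<close>, an image point whose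
        \<open>f\<close>-coordinate is below 1 comes from \<open>U\<close>.\<close>
      let ?T = "{p \<in> topspace ?P. p f \<in> {..<1}}"
      have "continuous_map ?P euclideanreal (\<lambda>p. p f)"
        using continuous_map_product_projection[OF f(1), of "\<lambda>_. top_of_set {0..1::real}"]
        by (simp add: continuous_map_in_subtopology)
      then have "openin ?P ?T"
        by (rule openin_continuous_map_preimage) simp
      then have "openin (subtopology ?P (?e ` topspace X)) (?T \<inter> ?e ` topspace X)"
        by (rule openin_subtopology_Int)
      moreover have "?e x \<in> topspace ?P" "?e x \<in> ?e ` topspace X"
        using x openin_subset[OF U] continuous_map_image_subset_topspace[OF con] by blast+
      then have "?e x \<in> ?T \<inter> ?e ` topspace X"
        using f(1,2) by simp
      moreover have "?T \<inter> ?e ` topspace X \<subseteq> ?e ` U"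
        using f(1,3) by fastforce
      ultimately show "\<exists>T. openin (subtopology ?P (?e ` topspace X)) T \<and> ?e x \<in> T \<and> T \<subseteq> ?e ` U"
        by blast
    qed
  qed
qed

section \<open>Elementary properties of compactifications\<close>

lemma compactification_dense:
  assumes "compactification X Y e" "openin Y U" "y \<in> U"
  obtains x where "x \<in> topspace X" "e x \<in> U"
proof -
  have "y \<in> Y closure_of (e ` topspace X)"
    using assms openin_subset unfolding compactification_def by fastforce
  then show thesis
    using assms(2,3) that by (auto simp: in_closure_of)
qed

lemma openin_compactification_image:
  assumes "locally_compact_space X" "compactification X Y e"
  shows "openin Y (e ` topspace X)"
proof (rule dense_locally_compact_openin_Hausdorff_space)
  have emb: "embedding_map X Y e"
    using assms(2) by (simp add: compactification_def)
  show "locally_compact_space (subtopology Y (e ` topspace X))"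
    using embedding_map_imp_homeomorphic_space[OF emb] assms(1) homeomorphic_locally_compact_space
    by blast
  show "e ` topspace X \<subseteq> topspace Y"
    using assms(2) closure_of_subset_topspace emb
    by (metis embedding_map_def homeomorphic_imp_surjective_map inf_le1 topspace_subtopology)
qed (use assms(2) in \<open>auto simp: compactification_def\<close>)

lemma compact_space_corona:
  assumes "locally_compact_space X" "compactification X Y e"
  shows "compact_space (corona X Y e)"
proof -
  have "closedin Y (topspace Y - e ` topspace X)"
    by (rule closedin_diff[OF closedin_topspace openin_compactification_image[OF assms]])
  then show ?thesis
    using assms(2) unfolding corona_def compactification_def
    by (intro compact_space_subtopology closedin_compact_space) auto
qed

lemma compactification_continuous_map:
  "compactification X Y e \<Longrightarrow> continuous_map X Y e"
  unfolding compactification_def embedding_map_def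
  by (meson continuous_map_in_subtopology homeomorphic_imp_continuous_map)

lemma compactin_compactification_preimage:
  assumes "compactification X Y e" "compactin Y L" "L \<subseteq> e ` topspace X"
  shows "compactin X {x \<in> topspace X. e x \<in> L}"
proof -
  have hom: "homeomorphic_map X (subtopology Y (e ` topspace X)) e"
    using assms(1) by (simp add: compactification_def embedding_map_def)
  have "e ` {x \<in> topspace X. e x \<in> L} = L"
    using assms(3) by blast
  moreover have "compactin (subtopology Y (e ` topspace X)) L"
    using assms(2,3) by (simp add: compactin_subtopology)
  ultimately show ?thesis
    using homeomorphic_map_compactness[OF hom, of "{x \<in> topspace X. e x \<in> L}"] by auto
qed

section \<open>From a zero-dimensional corona to vanishing oscillation\<close>

text \<open>A clopen subset \<open>D\<close> of the corona separates the corona points with g \<le>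
  a from those with g \<ge> b. Both \<open>D\<close> and its complement are compact, so they have
  disjoint open neighbourhoods in \<open>Z\<close>, and a connected set covered by these two stays
  in one of them.\<close>

lemma corona_dim_le_0_no_crossing:
  fixes g :: "'b \<Rightarrow> real"
  assumes "locally_compact_space X" and Z: "compactification X Z h"
    and dim: "corona X Z h dim_le 0" and g: "continuous_map Z euclideanreal g" and "a < b"
  obtains K where "compactin X K"
    and "\<And>x y. \<lbrakk>connected_component_of (subtopology X (topspace X - K)) x y; g (h x) \<le> a\<rbrakk>
      \<Longrightarrow> g (h y) < b"
proof -
  let ?C = "corona X Z h"
  have C: "topspace ?C = topspace Z - h ` topspace X"
    by (auto simp: corona_def)
  have gC: "continuous_map ?C euclideanreal g"
    unfolding corona_def by (rule continuous_map_from_subtopology[OF g])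
  have comC: "compact_space ?C"
    by (rule compact_space_corona[OF assms(1) Z])
  let ?A = "{z \<in> topspace ?C. g z \<in> {..a}}" and ?B = "{z \<in> topspace ?C. g z \<in> {b..}}"
  have AB: "closedin ?C ?A" "closedin ?C ?B"
    by (rule closedin_continuous_map_preimage[OF gC]; simp)+
  have "disjnt ?A ?B"
    using \<open>a < b\<close> by (auto simp: disjnt_iff)
  then obtain D where D: "closedin ?C D" "openin ?C D" "?A \<subseteq> D" "disjnt D ?B"
    using dim_le_0_clopen_separation[OF dim closedin_compact_space[OF comC AB(1)] AB(2)] by blast
  have "compactin ?C D" "compactin ?C (topspace ?C - D)"
    using closedin_compact_space[OF comC] D(1,2) by blast+
  then have com: "compactin Z D" "compactin Z (topspace ?C - D)"
    by (simp_all add: corona_def compactin_subtopology)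
  moreover have HZ: "Hausdorff_space Z" and cZ: "compact_space Z"
    using Z by (auto simp: compactification_def)
  ultimately obtain V W where VW: "openin Z V" "openin Z W" "D \<subseteq> V" "topspace ?C - D \<subseteq> W" "disjnt V W"
    using Hausdorff_space_compact_separation[OF HZ com] by (auto simp: disjnt_iff)
  \<comment> \<open>Trimming makes membership in \<open>V'\<close> and \<open>W'\<close> control
    \<open>g\<close>. The corona stays covered because \<open>D\<close> contains all its points with
    g \<le> a and none with g \<ge> b.\<close>
  define V' where "V' = V \<inter> {z \<in> topspace Z. g z \<in> {..<b}}"
  define W' where "W' = W \<inter> {z \<in> topspace Z. g z \<in> {a<..}}"
  have VW': "openin Z V'" "openin Z W'"
    unfolding V'_def W'_def
    by (intro openin_Int VW openin_continuous_map_preimage[OF g]; simp)+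
  have CVW: "topspace ?C \<subseteq> V' \<union> W'"
  proof
    fix z assume z: "z \<in> topspace ?C"
    show "z \<in> V' \<union> W'"
    proof (cases "z \<in> D")
      case True
      then have "\<not> b \<le> g z" using D(4) z by (auto simp: disjnt_iff)
      then show ?thesis using True VW(3) z C by (auto simp: V'_def)
    next
      case False
      then have "\<not> g z \<le> a" using D(3) z by blast
      then show ?thesis using False VW(4) z C by (auto simp: W'_def)
    qed
  qed
  \<comment> \<open>This compact set misses the corona, so it corresponds to a compact subset of
    \<open>X\<close>.\<close>
  let ?L = "topspace Z - (V' \<union> W')"
  let ?K = "{x \<in> topspace X. h x \<in> ?L}"
  show thesis
  proof
    show "compactin X ?K"
    proof (rule compactin_compactification_preimage[OF Z])
      show "compactin Z ?L"
        using VW' cZ closedin_compact_space by blast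
      show "?L \<subseteq> h ` topspace X"
        using CVW C by blast
    qed
    fix x y
    assume "connected_component_of (subtopology X (topspace X - ?K)) x y" and gx: "g (h x) \<le> a"
    then obtain T where T: "connectedin X T" "T \<subseteq> topspace X - ?K" "x \<in> T" "y \<in> T"
      by (auto simp: connected_component_of_def connectedin_subtopology)
    have conT: "connectedin Z (h ` T)"
      by (rule connectedin_continuous_map_image[OF compactification_continuous_map[OF Z] T(1)])
    have "h ` T \<subseteq> V' \<union> W'"
      using T(2) connectedin_subset_topspace[OF conT] by blast
    moreover have "V' \<inter> W' \<inter> h ` T = {}"
      using VW(5) by (auto simp: V'_def W'_def disjnt_iff)
    moreover have "h x \<in> V'"
      using gx T(3) calculation(1) by (auto simp: W'_def)
    ultimately have "W' \<inter> h ` T = {}"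
      using conT VW' T(3) unfolding connectedin by blast
    then have "h y \<in> V'"
      using \<open>h ` T \<subseteq> V' \<union> W'\<close> T(4) by blast
    then show "g (h y) < b"
      by (simp add: V'_def)
  qed
qed

text \<open>The hypothesis is applied to neighbouring points of a finite grid of mesh 1/N in [0,1],
  and the finitely many compact sets obtained are united.\<close>

lemma vanishing_oscillation_if_no_crossing:
  fixes f :: "'a \<Rightarrow> real"
  assumes f: "f \<in> topspace X \<rightarrow> {0..1}"
    and cross: "\<And>a b. a < b \<Longrightarrow> \<exists>K. compactin X K \<and>
      (\<forall>x y. connected_component_of (subtopology X (topspace X - K)) x y \<longrightarrow> f x \<le> a \<longrightarrow> f y < b)"
  shows "vanishing_oscillation X f"
  unfolding vanishing_oscillation_def
proof (intro allI impI)
  fix \<epsilon> :: real assume "\<epsilon> > 0"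
  \<comment> \<open>The factor 2 pays for two grid steps: one for rounding \<open>f x\<close> up to
    the grid, one for the gap between \<open>a\<close> and \<open>b\<close>.\<close>
  then obtain N :: nat where N: "2 / \<epsilon> < real N"
    using reals_Archimedean2 by blast
  then have N0: "real N > 0"
    using \<open>\<epsilon> > 0\<close> by (meson divide_pos_pos less_trans zero_less_numeral)
  have "\<exists>K. compactin X K \<and> (\<forall>x y. connected_component_of (subtopology X (topspace X - K)) x y
       \<longrightarrow> f x \<le> real i / N \<longrightarrow> f y < (real i + 1) / N)" for i :: nat
    using N0 by (intro cross) (simp add: divide_strict_right_mono)
  then obtain K where K: "\<And>i. compactin X (K i)"
    "\<And>i x y. \<lbrakk>connected_component_of (subtopology X (topspace X - K i)) x y; f x \<le> real i / N\<rbrakk>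
       \<Longrightarrow> f y < (real i + 1) / N"
    by metis
  let ?K = "\<Union>i\<le>N. K i"
  have less: "f y < f x + \<epsilon>" if xy: "connected_component_of (subtopology X (topspace X - ?K)) x y" for x y
  proof -
    have "x \<in> topspace X"
      using connected_component_in_topspace[OF xy] by simp
    then have fx: "0 \<le> f x" "f x \<le> 1"
      using f by auto
    define i where "i = nat \<lceil>f x * N\<rceil>"
    have ri: "real i = of_int \<lceil>f x * N\<rceil>"
      using fx N0 by (simp add: i_def)
    have le: "f x * N \<le> real i" "real i < f x * N + 1"
      unfolding ri by linarith+
    have "real i < real N + 1"
      using le(2) fx(2) N0 mult_right_mono[of "f x" 1 "real N"] by linarith
    then have "i \<le> N" by linarith
    then have "connected_component_of (subtopology X (topspace X - K i)) x y"
      by (intro connected_component_of_mono[OF xy]) auto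
    then have "f y < (real i + 1) / N"
      by (rule K(2)) (use le(1) N0 in \<open>simp add: field_simps\<close>)
    also have "\<dots> \<le> (f x * N + 2) / N"
      using le(2) N0 by (intro divide_right_mono) auto
    also have "\<dots> = f x + 2 / N"
      using N0 by (simp add: field_simps)
    also have "\<dots> < f x + \<epsilon>"
      using N N0 \<open>\<epsilon> > 0\<close> by (simp add: field_simps)
    finally show ?thesis .
  qed
  show "\<exists>K. compactin X K \<and> (\<forall>x y. connected_component_of (subtopology X (topspace X - K)) x y
       \<longrightarrow> dist (f x) (f y) < \<epsilon>)"
  proof (intro exI[of _ ?K] conjI allI impI)
    show "compactin X ?K"
      using K(1) by (intro compactin_Union) auto
    fix x y assume xy: "connected_component_of (subtopology X (topspace X - ?K)) x y"
    then have "connected_component_of (subtopology X (topspace X - ?K)) y x"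
      by (simp only: connected_component_of_sym)
    then show "dist (f x) (f y) < \<epsilon>"
      using less[OF xy] less[of y x] by (simp add: dist_real_def abs_less_iff)
  qed
qed

text \<open>This applies both to the Higson candidate itself and to the competitors it has to
  dominate.\<close>

lemma vanishing_oscillation_if_extends:
  fixes f :: "'a \<Rightarrow> real"
  assumes "locally_compact_space X" "compactification X Z h" "corona X Z h dim_le 0"
    and g: "continuous_map Z (top_of_set {0..1}) g" "\<And>x. x \<in> topspace X \<Longrightarrow> g (h x) = f x"
  shows "vanishing_oscillation X f"
proof (rule vanishing_oscillation_if_no_crossing)
  have gr: "continuous_map Z euclideanreal g" "g \<in> topspace Z \<rightarrow> {0..1}"
    using g(1) by (auto simp: continuous_map_in_subtopology)
  have "h ` topspace X \<subseteq> topspace Z"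
    by (rule continuous_map_image_subset_topspace[OF compactification_continuous_map[OF assms(2)]])
  then show "f \<in> topspace X \<rightarrow> {0..1}"
    using gr(2) g(2) by (metis Pi_I' PiE image_subset_iff)
  fix a b :: real assume "a < b"
  obtain K where K: "compactin X K"
    "\<And>x y. \<lbrakk>connected_component_of (subtopology X (topspace X - K)) x y; g (h x) \<le> a\<rbrakk> \<Longrightarrow> g (h y) < b"
    using corona_dim_le_0_no_crossing[OF assms(1-3) gr(1) \<open>a < b\<close>] by blast
  then show "\<exists>K. compactin X K \<and>
      (\<forall>x y. connected_component_of (subtopology X (topspace X - K)) x y \<longrightarrow> f x \<le> a \<longrightarrow> f y < b)"
    using connected_component_in_topspace[of "subtopology X (topspace X - K)"] g(2)
    by (intro exI[of _ K]) (metis DiffE topspace_subtopology IntD1)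
qed

section \<open>From extendability to a zero-dimensional corona\<close>

text \<open>The components of X - K on which \<open>g\<close> is somewhere near g c form a set
  \<open>W\<close>. Its indicator, cut off near \<open>K\<close>, has vanishing oscillation, so it
  extends to some \<open>G\<close>. On the corona \<open>G\<close> takes only the values 0 and 1, so
  a level set of it is clopen.\<close>

lemma corona_clopen_separation:
  fixes g :: "'b \<Rightarrow> real"
  assumes lc: "locally_compact_space X" and lcn: "locally_connected_space X"
    and haus: "Hausdorff_space X" and Y: "compactification X Y e"
    and ext: "\<forall>f :: 'a \<Rightarrow> real. continuous_map X (top_of_set {0..1}) f \<longrightarrow> vanishing_oscillation X f
       \<longrightarrow> (\<exists>G. continuous_map Y (top_of_set {0..1}) G \<and> (\<forall>x\<in>topspace X. G (e x) = f x))"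
    and g: "continuous_map Y euclideanreal g" "vanishing_oscillation X (g \<circ> e)"
    and cd: "c \<in> topspace (corona X Y e)" "d \<in> topspace (corona X Y e)" "g c < g d"
  obtains D where "closedin (corona X Y e) D" "openin (corona X Y e) D" "c \<in> D" "d \<notin> D"
proof -
  let ?C = "corona X Y e"
  have C: "topspace ?C = topspace Y - e ` topspace X"
    by (auto simp: corona_def)
  \<comment> \<open>\<open>W\<close> is selected by values below g c + \<delta>. Oscillation less
    than \<delta> keeps all its values below g c + 2\<delta>, which is still less than g d.\<close>
  define \<delta> where "\<delta> = (g d - g c) / 3"
  have \<delta>: "\<delta> > 0" and g\<delta>: "g d = g c + 3 * \<delta>"
    using cd(3) by (auto simp: \<delta>_def field_simps)
  obtain K where K: "compactin X K"
    and osc: "\<And>x y. connected_component_of (subtopology X (topspace X - K)) x y \<Longrightarrow>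
      dist (g (e x)) (g (e y)) < \<delta>"
    using g(2) \<delta> unfolding vanishing_oscillation_def o_def by blast
  obtain V L where VL: "openin X V" "compactin X L" "K \<subseteq> V" "V \<subseteq> L"
    using lc haus K locally_compact_space_compact_closed_compact by metis
  let ?S = "subtopology X (topspace X - K)"
  have opS: "openin X (topspace X - K)"
    using K haus compactin_imp_closedin by blast
  have comp_open: "openin X (connected_component_of_set ?S x)" if "x \<in> topspace X - K" for x
    using lcn opS that unfolding locally_connected_space_eq_open_connected_component_of by blast
  define W where "W = {y. \<exists>x. connected_component_of ?S x y \<and> g (e x) < g c + \<delta>}"
  \<comment> \<open>Both \<open>W\<close> and \<open>W'\<close> are unions of components of X - K,
    which are open by local connectedness.\<close>
  define W' where "W' = (topspace X - K) - W"
  have W_cong: "x \<in> W \<longleftrightarrow> y \<in> W" if "connected_component_of ?S x y" for x y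
  proof -
    have "connected_component_of ?S y x"
      using that by (simp only: connected_component_of_sym)
    then show ?thesis
      using that connected_component_of_trans[of ?S] unfolding W_def by blast
  qed
  have W_sub: "W \<subseteq> topspace X - K"
    using connected_component_in_topspace[of ?S] unfolding W_def by auto
  have "openin X W"
  proof (subst openin_subopen, intro ballI)
    fix y assume "y \<in> W"
    then show "\<exists>T. openin X T \<and> y \<in> T \<and> T \<subseteq> W"
      using W_sub comp_open[of y] W_cong connected_component_of_refl[of ?S y]
      by (intro exI[of _ "connected_component_of_set ?S y"]) auto
  qed
  have "openin X W'"
  proof (subst openin_subopen, intro ballI)
    fix y assume y: "y \<in> W'"
    then have "connected_component_of_set ?S y \<subseteq> W'"
      using W_cong[of y] connected_component_in_topspace[of ?S y] unfolding W'_def by auto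
    then show "\<exists>T. openin X T \<and> y \<in> T \<and> T \<subseteq> W'"
      using y comp_open[of y] connected_component_of_refl[of ?S y]
      by (intro exI[of _ "connected_component_of_set ?S y"]) (auto simp: W'_def)
  qed
  have "closedin X (topspace X - V)" "disjnt (topspace X - V) K"
    using VL by (auto simp: disjnt_iff)
  moreover have "completely_regular_space X"
    using lc haus by (simp add: locally_compact_regular_imp_completely_regular_space)
  ultimately obtain u :: "'a \<Rightarrow> real" where u: "continuous_map X (top_of_set {0..1}) u"
    "u ` K \<subseteq> {0}" "u ` (topspace X - V) \<subseteq> {1}"
    using Urysohn_completely_regular_closed_compact[of 0 1 X "topspace X - V" K] K by auto
  have u': "continuous_map X euclideanreal u" "\<And>x. x \<in> topspace X \<Longrightarrow> u x \<in> {0..1}"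
    using u(1) by (auto simp: continuous_map_in_subtopology)
  define \<phi> where "\<phi> x = (if x \<in> W then u x else 0)" for x
  have \<phi>1: "\<phi> x = (if x \<in> W then 1 else 0)" if "x \<in> topspace X - L" for x
    using that u(3) VL(4) by (auto simp: \<phi>_def)
  have "continuous_map X euclideanreal \<phi>"
    unfolding continuous_map_def
  proof (intro conjI allI impI)
    fix B :: "real set" assume "openin euclideanreal B"
    then have uB: "openin X {x \<in> topspace X. u x \<in> B}"
      by (rule openin_continuous_map_preimage[OF u'(1)])
    show "openin X {x \<in> topspace X. \<phi> x \<in> B}"
    \<comment> \<open>Points outside \<open>W\<close> lie in \<open>W'\<close> or in
      \<open>K\<close>. As \<open>u\<close> vanishes on \<open>K\<close>, if \<open>B\<close>
      contains 0 the points of \<open>K\<close> already belong to the preimage under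
      \<open>u\<close>; otherwise the whole preimage lies in \<open>W\<close>.\<close>
    proof (cases "0 \<in> B")
      case True
      have "{x \<in> topspace X. \<phi> x \<in> B} = {x \<in> topspace X. u x \<in> B} \<union> W'"
        using True W_sub u(2) by (auto simp: \<phi>_def W'_def)
      then show ?thesis
        using uB \<open>openin X W'\<close> by auto
    next
      case False
      then have "{x \<in> topspace X. \<phi> x \<in> B} = {x \<in> topspace X. u x \<in> B} \<inter> W"
        using W_sub by (auto simp: \<phi>_def)
      then show ?thesis
        using uB \<open>openin X W\<close> by auto
    qed
  qed auto
  then have "continuous_map X (top_of_set {0..1}) \<phi>"
    using u'(2) by (auto simp: continuous_map_in_subtopology \<phi>_def)
  \<comment> \<open>Off \<open>L\<close> the function \<phi> is exactly the indicator of
    \<open>W\<close>, hence constant on components of X - L, each of which lies in a component of X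
    - K.\<close>
  moreover have "vanishing_oscillation X \<phi>"
    unfolding vanishing_oscillation_def
  proof (intro allI impI exI[of _ L] conjI VL(2))
    fix \<epsilon> :: real and x y
    assume "\<epsilon> > 0" and xy: "connected_component_of (subtopology X (topspace X - L)) x y"
    then have "connected_component_of ?S x y"
      using VL(3,4) by (auto elim!: connected_component_of_mono)
    then show "dist (\<phi> x) (\<phi> y) < \<epsilon>"
      using \<open>\<epsilon> > 0\<close> W_cong[of x y] connected_component_in_topspace[OF xy] by (simp add: \<phi>1)
  qed
  ultimately obtain G where G: "continuous_map Y (top_of_set {0..1}) G"
    "\<And>x. x \<in> topspace X \<Longrightarrow> G (e x) = \<phi> x"
    using ext by blast
  have G': "continuous_map Y euclideanreal G"
    using G(1) by (simp add: continuous_map_in_subtopology)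
  let ?Q = "topspace Y - e ` L"
  have "openin Y ?Q"
    using image_compactin[OF VL(2) compactification_continuous_map[OF Y]] Y compactin_imp_closedin
    unfolding compactification_def by blast
  \<comment> \<open>The image of \<open>L\<close> is closed and misses the corona, so by density any
    corona point is approximated by points of \<open>X\<close> outside \<open>L\<close>, with
    \<open>g\<close> and \<open>G\<close> controlled at once.\<close>
  have approx: "\<exists>x\<in>topspace X - L. g (e x) \<in> S \<and> \<phi> x \<in> T"
    if z: "z \<in> topspace ?C" "g z \<in> S" "G z \<in> T" and ST: "open S" "open T" for z S T
  proof -
    have "openin Y (?Q \<inter> ({z \<in> topspace Y. g z \<in> S} \<inter> {z \<in> topspace Y. G z \<in> T}))"
      using ST \<open>openin Y ?Q\<close> openin_continuous_map_preimage[OF g(1)] openin_continuous_map_preimage[OF G']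
      by (intro openin_Int) auto
    moreover have "z \<in> ?Q \<inter> ({z \<in> topspace Y. g z \<in> S} \<inter> {z \<in> topspace Y. G z \<in> T})"
      using z C compactin_subset_topspace[OF VL(2)] by auto
    ultimately obtain x where "x \<in> topspace X"
      "e x \<in> ?Q \<inter> ({z \<in> topspace Y. g z \<in> S} \<inter> {z \<in> topspace Y. G z \<in> T})"
      using compactification_dense[OF Y] by blast
    then show ?thesis
      using G(2) by force
  qed
  have G01: "G z = 0 \<or> G z = 1" if z: "z \<in> topspace ?C" for z
  proof (rule ccontr)
    assume "\<not> ?thesis"
    then show False
      using approx[OF z, of UNIV "- {0, 1}"] \<phi>1 by (auto simp: open_Compl split: if_splits)
  qed
  have GC: "continuous_map ?C euclideanreal G"
    unfolding corona_def by (rule continuous_map_from_subtopology[OF G'])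
  let ?D = "{z \<in> topspace ?C. G z \<in> {1/2..}}"
  \<comment> \<open>The value 1/2 is not attained on the corona, so the closed and the open
    condition define the same set.\<close>
  have "?D = {z \<in> topspace ?C. G z \<in> {1/2<..}}"
    using G01 by fastforce
  then have "openin ?C ?D"
    using openin_continuous_map_preimage[OF GC, of "{1/2<..}"] by simp
  moreover have "closedin ?C ?D"
    by (rule closedin_continuous_map_preimage[OF GC]) simp
  moreover have "c \<in> ?D"
  proof (rule ccontr)
    assume "c \<notin> ?D"
    then obtain x where x: "x \<in> topspace X - L" "g (e x) < g c + \<delta>" "\<phi> x < 1/2"
      using approx[OF cd(1), of "{..<g c + \<delta>}" "{..<1/2}"] \<delta> cd(1) by auto
    then have "x \<in> W"
      using VL(3,4) connected_component_of_refl[of ?S x] unfolding W_def by auto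
    then show False
      using x(3) \<phi>1[OF x(1)] by simp
  qed
  moreover have "d \<notin> ?D"
  proof
    assume "d \<in> ?D"
    then have "G d > 1/3" by auto
    then obtain x where x: "x \<in> topspace X - L" "g (e x) > g c + 2 * \<delta>" "\<phi> x > 1/3"
      using approx[OF cd(2), of "{g c + 2 * \<delta><..}" "{1/3<..}"] \<delta> g\<delta> by auto
    then have "x \<in> W"
      using \<phi>1[OF x(1)] by (auto split: if_splits)
    then obtain w where "dist (g (e w)) (g (e x)) < \<delta>" "g (e w) < g c + \<delta>"
      using osc unfolding W_def by blast
    then show False
      using x(2) by (simp add: dist_real_def)
  qed
  ultimately show thesis
    using that by blast
qed

text \<open>In a compact corona it suffices to separate pairs of points by clopen sets. If
  \<open>g\<close> orders the two points the other way, the complement of the clopen set is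
  taken.\<close>

lemma corona_dim_le_0:
  assumes "locally_compact_space X" "locally_connected_space X" "Hausdorff_space X"
    "compactification X Y e"
    and "\<forall>f :: 'a \<Rightarrow> real. continuous_map X (top_of_set {0..1}) f \<longrightarrow> vanishing_oscillation X f
       \<longrightarrow> (\<exists>G. continuous_map Y (top_of_set {0..1}) G \<and> (\<forall>x\<in>topspace X. G (e x) = f x))"
    and sep: "\<And>c d. \<lbrakk>c \<in> topspace (corona X Y e); d \<in> topspace (corona X Y e); c \<noteq> d\<rbrakk> \<Longrightarrow>
      \<exists>g :: 'b \<Rightarrow> real. continuous_map Y euclideanreal g \<and> vanishing_oscillation X (g \<circ> e) \<and> g c \<noteq> g d"
  shows "corona X Y e dim_le 0"
proof (rule compact_space_imp_dim_le_0)
  show "compact_space (corona X Y e)"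
    using assms(1,4) by (rule compact_space_corona)
  fix c d assume cd: "c \<in> topspace (corona X Y e)" "d \<in> topspace (corona X Y e)" "c \<noteq> d"
  obtain g :: "'b \<Rightarrow> real" where g: "continuous_map Y euclideanreal g"
    "vanishing_oscillation X (g \<circ> e)" "g c \<noteq> g d"
    using sep[OF cd] by blast
  note sepD = corona_clopen_separation[OF assms(1-5) g(1,2)]
  consider "g c < g d" | "g d < g c"
    using g(3) by linarith
  then show "\<exists>D. closedin (corona X Y e) D \<and> openin (corona X Y e) D \<and> c \<in> D \<and> d \<notin> D"
  proof cases
    case 1
    then show ?thesis
      using sepD[OF cd(1,2)] by metis
  next
    case 2
    then obtain D where "closedin (corona X Y e) D" "openin (corona X Y e) D" "d \<in> D" "c \<notin> D"
      using sepD[OF cd(2,1)] by metis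
    then show ?thesis
      using cd(1) by (intro exI[of _ "topspace (corona X Y e) - D"]) auto
  qed
qed

section \<open>Domination through extension of functions\<close>

lemma unit_interval_functions_separate:
  assumes "compact_space Z" "Hausdorff_space Z" "closedin Z A" "x \<in> topspace Z" "x \<notin> A"
  obtains f :: "'b \<Rightarrow> real"
  where "continuous_map Z (top_of_set {0..1}) f" "f x = 0" "f ` A \<subseteq> {1}"
proof -
  have "completely_regular_space Z"
    using assms(1,2) compact_Hausdorff_or_regular_imp_normal_space normal_imp_completely_regular_space
    by blast
  then show thesis
    using that assms(3-5) unfolding completely_regular_space_def by (metis DiffI image_subset_iff_funcset)
qed

text \<open>\<open>Z\<close> embeds into the cube indexed by all its continuous functions into
  [0,1]. The extensions to \<open>Y\<close> of their restrictions to \<open>X\<close> are the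
  coordinates of a map from \<open>Y\<close> to that cube; it lands in the copy of \<open>Z\<close>,
  and the inverse of the embedding completes the map.\<close>

lemma dominates_if_extends:
  assumes Y: "compactification X Y e" and Z: "compactification X Z h"
    and ext: "\<And>g. continuous_map Z (top_of_set {0..1::real}) g \<Longrightarrow>
       \<exists>G. continuous_map Y (top_of_set {0..1}) G \<and> (\<forall>x\<in>topspace X. G (e x) = g (h x))"
  shows "dominates X Y e Z h"
proof -
  define F where "F = {g. continuous_map Z (top_of_set {0..1::real}) g}"
  let ?P = "product_topology (\<lambda>_. top_of_set {0..1::real}) F"
  let ?j = "\<lambda>z. \<lambda>g\<in>F. g z"
  have cZ: "compact_space Z" and hZ: "Hausdorff_space Z"
    using Z by (auto simp: compactification_def)
  have emb: "embedding_map Z ?P ?j"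
  proof (rule embedding_map_into_cube)
    show "t1_space Z"
      using hZ by (rule Hausdorff_imp_t1_space)
    show "\<exists>f\<in>F. f x = 0 \<and> f ` A \<subseteq> {1}" if Ax: "closedin Z A" "x \<in> topspace Z" "x \<notin> A" for A x
    proof -
      obtain f where "continuous_map Z (top_of_set {0..1::real}) f" "f x = 0" "f ` A \<subseteq> {1}"
        using unit_interval_functions_separate[OF cZ hZ Ax] .
      then show ?thesis
        unfolding F_def by blast
    qed
  qed (simp add: F_def)
  then have hom: "homeomorphic_map Z (subtopology ?P (?j ` topspace Z)) ?j"
    by (simp add: embedding_map_def)
  then obtain k where k: "continuous_map (subtopology ?P (?j ` topspace Z)) Z k"
    "\<And>z. z \<in> topspace Z \<Longrightarrow> k (?j z) = z"
    unfolding homeomorphic_map_maps homeomorphic_maps_def by blast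
  obtain G where G: "\<And>g. g \<in> F \<Longrightarrow> continuous_map Y (top_of_set {0..1}) (G g)"
    "\<And>g x. \<lbrakk>g \<in> F; x \<in> topspace X\<rbrakk> \<Longrightarrow> G g (e x) = g (h x)"
    using ext unfolding F_def by (metis mem_Collect_eq)
  let ?\<Psi> = "\<lambda>y. \<lambda>g\<in>F. G g y"
  have \<Psi>: "continuous_map Y ?P ?\<Psi>"
    using G(1) by (auto simp: continuous_map_componentwise)
  have \<Psi>e: "?\<Psi> (e x) = ?j (h x)" if "x \<in> topspace X" for x
    using G(2) that by auto
  have hX: "h ` topspace X \<subseteq> topspace Z"
    by (rule continuous_map_image_subset_topspace[OF compactification_continuous_map[OF Z]])
  have "compactin ?P (?j ` topspace Z)"
    using hom cZ by (metis compact_space_def homeomorphic_imp_continuous_map image_compactin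
        continuous_map_in_subtopology)
  moreover have "Hausdorff_space ?P"
    by (simp add: Hausdorff_space_product_topology Hausdorff_space_subtopology)
  ultimately have clo: "closedin ?P (?j ` topspace Z)"
    by (simp add: compactin_imp_closedin)
  \<comment> \<open>On the dense image of \<open>X\<close> the map has values in the copy of
    \<open>Z\<close>, which is compact and hence closed.\<close>
  have "?\<Psi> ` topspace Y = ?\<Psi> ` (Y closure_of (e ` topspace X))"
    using Y by (simp add: compactification_def)
  also have "\<dots> \<subseteq> ?P closure_of (?\<Psi> ` e ` topspace X)"
    by (rule continuous_map_image_closure_subset[OF \<Psi>])
  also have "\<dots> \<subseteq> ?j ` topspace Z"
    using \<Psi>e hX by (intro closure_of_minimal clo) auto
  finally have "continuous_map Y (subtopology ?P (?j ` topspace Z)) ?\<Psi>"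
    using \<Psi> by (auto simp: continuous_map_in_subtopology)
  then have "continuous_map Y Z (k \<circ> ?\<Psi>)"
    using k(1) continuous_map_compose by blast
  moreover have "(k \<circ> ?\<Psi>) (e x) = h x" if "x \<in> topspace X" for x
    using \<Psi>e[OF that] k(2) hX that by auto
  ultimately show ?thesis
    unfolding dominates_def by blast
qed

section \<open>The Higson and the Freudenthal compactification\<close>

lemma vanishing_oscillation_cong:
  assumes "\<And>x. x \<in> topspace X \<Longrightarrow> f x = g x"
  shows "vanishing_oscillation X f \<longleftrightarrow> vanishing_oscillation X g"
proof -
  have "dist (f x) (f y) = dist (g x) (g y)"
    if "connected_component_of (subtopology X S) x y" for S x y
    using connected_component_in_topspace[OF that] assms by simp
  then show ?thesis
    unfolding vanishing_oscillation_def by (smt (verit, best))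
qed

context
  fixes X :: "'a topology"
  assumes sc: "sigma_compact_space X" and lc: "locally_compact_space X"
    and lcn: "locally_connected_space X" and haus: "Hausdorff_space X"
    and fin: "finite (connected_components_of X)"
begin

lemma higson_compactification_iff:
  "higson_compactification X (freudenthal_equiv X) Y e \<longleftrightarrow>
     compactification X Y e \<and>
     (\<forall>f :: 'a \<Rightarrow> real. f \<in> topspace X \<rightarrow> {0..1} \<longrightarrow>
        ((\<exists>g. continuous_map Y (top_of_set {0..1}) g \<and> (\<forall>x\<in>topspace X. g (e x) = f x)) \<longleftrightarrow>
         continuous_map X (top_of_set {0..1}) f \<and> vanishing_oscillation X f))"
  unfolding higson_compactification_def slowly_oscillating_iff[OF sc lc lcn haus fin] ..

text \<open>One half of the Higson condition is automatic here: a corona of dimension 0 forces every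
  extendable function to have vanishing oscillation.\<close>

lemma higson_compactification_if_corona_dim_le_0:
  assumes Y: "compactification X Y e" and "corona X Y e dim_le 0"
    and ext: "\<And>f :: 'a \<Rightarrow> real. \<lbrakk>continuous_map X (top_of_set {0..1}) f; vanishing_oscillation X f\<rbrakk>
       \<Longrightarrow> \<exists>g. continuous_map Y (top_of_set {0..1}) g \<and> (\<forall>x\<in>topspace X. g (e x) = f x)"
  shows "higson_compactification X (freudenthal_equiv X) Y e"
  unfolding higson_compactification_iff
proof (intro conjI allI impI Y iffI; (elim exE conjE)?)
  fix f :: "'a \<Rightarrow> real" and g
  assume g: "continuous_map Y (top_of_set {0..1}) g" "\<forall>x\<in>topspace X. g (e x) = f x"
  have "continuous_map X (top_of_set {0..1}) (g \<circ> e)"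
    by (rule continuous_map_compose[OF compactification_continuous_map[OF Y] g(1)])
  then show "continuous_map X (top_of_set {0..1}) f"
    by (rule continuous_map_eq) (use g(2) in simp)
  show "vanishing_oscillation X f"
    using vanishing_oscillation_if_extends[OF lc Y assms(2) g(1)] g(2) by blast
qed (rule ext)

text \<open>\<open>Y\<close> is the closure of \<open>X\<close> in the cube indexed by the
  admissible functions. The coordinate projections extend these functions and separate the points of
  the corona, which makes its dimension 0.\<close>

lemma exists_higson_compactification:
  "\<exists>(Y :: (('a \<Rightarrow> real) \<Rightarrow> real) topology) e.
     higson_compactification X (freudenthal_equiv X) Y e \<and> corona X Y e dim_le 0"
proof -
  define F where "F = {f :: 'a \<Rightarrow> real. continuous_map X (top_of_set {0..1}) f \<and> vanishing_oscillation X f}"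
  let ?P = "product_topology (\<lambda>_. top_of_set {0..1::real}) F"
  let ?e = "\<lambda>x. \<lambda>f\<in>F. f x"
  define Y where "Y = subtopology ?P (?P closure_of (?e ` topspace X))"
  have emb: "embedding_map X ?P ?e"
  proof (rule embedding_map_into_cube)
    show "t1_space X"
      using haus by (rule Hausdorff_imp_t1_space)
    fix A x assume A: "closedin X A" "x \<in> topspace X" "x \<notin> A"
    then have "compactin X {x}" by simp
    then obtain V L where VL: "openin X V" "compactin X L" "{x} \<subseteq> V" "V \<subseteq> L"
      using lc haus locally_compact_space_compact_closed_compact by metis
    have "closedin X (A \<union> (topspace X - V))" "disjnt (A \<union> (topspace X - V)) {x}"
      using A VL by (auto simp: disjnt_iff)
    moreover have "completely_regular_space X"
      using lc haus by (simp add: locally_compact_regular_imp_completely_regular_space)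
    ultimately obtain u :: "'a \<Rightarrow> real" where u: "continuous_map X (top_of_set {0..1}) u"
      "u ` {x} \<subseteq> {0}" "u ` (A \<union> (topspace X - V)) \<subseteq> {1}"
      using Urysohn_completely_regular_closed_compact[of 0 1 X "A \<union> (topspace X - V)" "{x}"]
        \<open>compactin X {x}\<close> by auto
    \<comment> \<open>Local compactness allows \<open>u\<close> to be constantly 1 outside a compact
      set, so there is no oscillation there at all.\<close>
    have "vanishing_oscillation X u"
      unfolding vanishing_oscillation_def
    proof (intro allI impI exI[of _ L] conjI VL(2))
      fix \<epsilon> :: real and y z
      assume "\<epsilon> > 0" and yz: "connected_component_of (subtopology X (topspace X - L)) y z"
      have "y \<in> topspace X - V" "z \<in> topspace X - V"
        using connected_component_in_topspace[OF yz] VL(4) by auto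
      then have "u y = 1" "u z = 1"
        using u(3) by blast+
      then show "dist (u y) (u z) < \<epsilon>"
        using \<open>\<epsilon> > 0\<close> by simp
    qed
    then show "\<exists>f\<in>F. f x = 0 \<and> f ` A \<subseteq> {1}"
      using u by (intro bexI[of _ u]) (auto simp: F_def)
  qed (simp add: F_def)
  have eP: "?e ` topspace X \<subseteq> topspace ?P"
    using emb unfolding embedding_map_def
    by (meson continuous_map_image_subset_topspace continuous_map_in_subtopology
        homeomorphic_imp_continuous_map)
  then have eY: "?e ` topspace X \<subseteq> ?P closure_of (?e ` topspace X)"
    by (rule closure_of_subset)
  have comp: "compactification X Y ?e"
    unfolding compactification_def
  proof (intro conjI)
    have "compact_space ?P"
      by (simp add: compact_space_product_topology compact_space_subtopology)
    then show "compact_space Y"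
      unfolding Y_def by (intro compact_space_subtopology closedin_compact_space) auto
    show "Hausdorff_space Y"
      unfolding Y_def
      by (intro Hausdorff_space_subtopology)
        (simp add: Hausdorff_space_product_topology Hausdorff_space_subtopology)
    show "embedding_map X Y ?e"
      using emb eY unfolding Y_def embedding_map_in_subtopology by blast
    show "Y closure_of (?e ` topspace X) = topspace Y"
      using closure_of_subset_topspace[of ?P "?e ` topspace X"]
      unfolding Y_def closure_of_subtopology topspace_subtopology Int_absorb1[OF eY] by blast
  qed
  have proj: "continuous_map Y (top_of_set {0..1}) (\<lambda>p. p f)" if "f \<in> F" for f
    unfolding Y_def
    by (rule continuous_map_from_subtopology[OF continuous_map_product_projection[OF that]])
  have ext: "\<exists>g. continuous_map Y (top_of_set {0..1}) g \<and> (\<forall>x\<in>topspace X. g (?e x) = f x)"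
    if "continuous_map X (top_of_set {0..1}) f" "vanishing_oscillation X f" for f :: "'a \<Rightarrow> real"
    using that by (intro exI[of _ "\<lambda>p. p f"]) (simp add: proj F_def)
  have "corona X Y ?e dim_le 0"
  proof (rule corona_dim_le_0[OF lc lcn haus comp])
    fix c d assume cd: "c \<in> topspace (corona X Y ?e)" "d \<in> topspace (corona X Y ?e)" "c \<noteq> d"
    then have "c \<in> topspace ?P" "d \<in> topspace ?P"
      by (auto simp: corona_def Y_def)
    then obtain f where f: "f \<in> F" "c f \<noteq> d f"
      using cd(3) by (metis PiE_ext topspace_product_topology)
    have "vanishing_oscillation X ((\<lambda>p. p f) \<circ> ?e) = vanishing_oscillation X f"
      using f(1) by (intro vanishing_oscillation_cong) simp
    then show "\<exists>g. continuous_map Y euclideanreal g \<and> vanishing_oscillation X (g \<circ> ?e) \<and> g c \<noteq> g d"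
      using f proj[OF f(1)] by (intro exI[of _ "\<lambda>p. p f"]) (simp add: F_def continuous_map_in_subtopology)
  qed (use ext in blast)
  then show ?thesis
    using higson_compactification_if_corona_dim_le_0[OF comp _ ext] by blast
qed

text \<open>Urysohn functions on \<open>Y\<close> separate corona points and, being extensions, have
  vanishing oscillation on \<open>X\<close>; this gives dimension 0. For domination, functions on a
  competitor \<open>Z\<close> restrict to functions of vanishing oscillation, which extend to
  \<open>Y\<close>.\<close>

lemma higson_imp_freudenthal:
  assumes Y: "higson_compactification X (freudenthal_equiv X) Y e"
  shows "freudenthal_compactification T X Y e"
proof -
  have comp: "compactification X Y e"
    and iff: "\<And>f :: 'a \<Rightarrow> real. f \<in> topspace X \<rightarrow> {0..1} \<Longrightarrow>
      (\<exists>g. continuous_map Y (top_of_set {0..1}) g \<and> (\<forall>x\<in>topspace X. g (e x) = f x)) \<longleftrightarrow>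
      continuous_map X (top_of_set {0..1}) f \<and> vanishing_oscillation X f"
    using Y unfolding higson_compactification_iff by blast+
  have ext: "\<exists>g. continuous_map Y (top_of_set {0..1}) g \<and> (\<forall>x\<in>topspace X. g (e x) = f x)"
    if "continuous_map X (top_of_set {0..1}) f" "vanishing_oscillation X f" for f :: "'a \<Rightarrow> real"
    using that iff[of f] by (simp add: continuous_map_in_subtopology)
  have cY: "compact_space Y" and hY: "Hausdorff_space Y"
    using comp by (auto simp: compactification_def)
  have dim: "corona X Y e dim_le 0"
  proof (rule corona_dim_le_0[OF lc lcn haus comp])
    fix c d assume cd: "c \<in> topspace (corona X Y e)" "d \<in> topspace (corona X Y e)" "c \<noteq> d"
    then have "closedin Y {d}" "c \<in> topspace Y" "c \<notin> {d}"
      using hY by (auto simp: corona_def closedin_Hausdorff_singleton)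
    then obtain g :: "'b \<Rightarrow> real" where g: "continuous_map Y (top_of_set {0..1}) g" "g c = 0" "g ` {d} \<subseteq> {1}"
      using unit_interval_functions_separate[OF cY hY] by metis
    have "continuous_map X (top_of_set {0..1}) (g \<circ> e)"
      by (rule continuous_map_compose[OF compactification_continuous_map[OF comp] g(1)])
    then have "vanishing_oscillation X (g \<circ> e)"
      using iff[of "g \<circ> e"] g(1) by (auto simp: continuous_map_in_subtopology)
    then show "\<exists>g :: 'b \<Rightarrow> real. continuous_map Y euclideanreal g \<and> vanishing_oscillation X (g \<circ> e) \<and> g c \<noteq> g d"
      using g by (intro exI[of _ g]) (auto simp: continuous_map_in_subtopology)
  qed (use ext in blast)
  moreover have "dominates X Y e Z h"
    if Z: "compactification X Z h" "corona X Z h dim_le 0" for Z :: "'c topology" and h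
  proof (rule dominates_if_extends[OF comp Z(1)])
    fix g assume g: "continuous_map Z (top_of_set {0..1::real}) g"
    have "continuous_map X (top_of_set {0..1}) (g \<circ> h)"
      by (rule continuous_map_compose[OF compactification_continuous_map[OF Z(1)] g])
    moreover have "vanishing_oscillation X (g \<circ> h)"
      by (rule vanishing_oscillation_if_extends[OF lc Z g]) simp
    ultimately show "\<exists>G. continuous_map Y (top_of_set {0..1}) G \<and> (\<forall>x\<in>topspace X. G (e x) = g (h x))"
      using ext[of "g \<circ> h"] by simp
  qed
  ultimately show ?thesis
    using comp unfolding freudenthal_compactification_def by blast
qed

text \<open>The type is fixed so that the Higson compactification \<open>Z\<close> constructed above
  is among the competitors. As \<open>Y\<close> dominates it, every admissible function extends to
  \<open>Z\<close> and is pulled back to \<open>Y\<close>.\<close>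

lemma freudenthal_imp_higson:
  assumes "freudenthal_compactification TYPE(('a \<Rightarrow> real) \<Rightarrow> real) X Y e"
  shows "higson_compactification X (freudenthal_equiv X) Y e"
proof -
  obtain Z :: "(('a \<Rightarrow> real) \<Rightarrow> real) topology" and h where
    Z: "higson_compactification X (freudenthal_equiv X) Z h" "corona X Z h dim_le 0"
    using exists_higson_compactification by blast
  have Y: "compactification X Y e" "corona X Y e dim_le 0" "dominates X Y e Z h"
    using assms Z unfolding freudenthal_compactification_def higson_compactification_iff by blast+
  then obtain \<phi> where \<phi>: "continuous_map Y Z \<phi>" "\<And>x. x \<in> topspace X \<Longrightarrow> \<phi> (e x) = h x"
    unfolding dominates_def by blast
  show ?thesis
  proof (rule higson_compactification_if_corona_dim_le_0[OF Y(1,2)])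
    fix f :: "'a \<Rightarrow> real"
    assume f: "continuous_map X (top_of_set {0..1}) f" "vanishing_oscillation X f"
    then have "f \<in> topspace X \<rightarrow> {0..1}"
      by (simp add: continuous_map_in_subtopology)
    then obtain g where g: "continuous_map Z (top_of_set {0..1}) g" "\<And>x. x \<in> topspace X \<Longrightarrow> g (h x) = f x"
      using Z(1) f unfolding higson_compactification_iff by blast
    then show "\<exists>g. continuous_map Y (top_of_set {0..1}) g \<and> (\<forall>x\<in>topspace X. g (e x) = f x)"
      using continuous_map_compose[OF \<phi>(1) g(1)] \<phi>(2) by (intro exI[of _ "g \<circ> \<phi>"]) simp
  qed
qed

end

text \<open>Both compactifications are given by properties, so they are identified by implications
  in both directions. Existence ensures that the Higson property is satisfiable.\<close>

theorem theorem6p2: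
  fixes X :: "'a topology"
  assumes "sigma_compact_space X" "locally_compact_space X" "locally_connected_space X"
    "Hausdorff_space X"
    and "finite (connected_components_of X)"
  shows
    "(\<exists>(Y :: (('a \<Rightarrow> real) \<Rightarrow> real) topology) e.
        higson_compactification X (freudenthal_equiv X) Y e) \<and>
     (\<forall>(Y :: 'b topology) e.
        (higson_compactification X (freudenthal_equiv X) Y e \<longrightarrow>
           freudenthal_compactification TYPE('c) X Y e) \<and>
        (freudenthal_compactification TYPE(('a \<Rightarrow> real) \<Rightarrow> real) X Y e \<longrightarrow>
           higson_compactification X (freudenthal_equiv X) Y e))"
  using exists_higson_compactification[OF assms] higson_imp_freudenthal[OF assms]
    freudenthal_imp_higson[OF assms] by blast

end
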